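(* Let $\mu\in\mathbb{R}$ and $\eta\in(0,1)$ be given. For $\kappa\in(0,\infty)$ and $a\in(0,\infty)$ let $\delta_x=(x-\mu)/\sqrt{1-I_1(\kappa)/I_0(\kappa)}$, $\widetilde{\delta}_x=\delta_x/\sqrt{2}$, and $B_{\mu,\kappa}(a)=\{x\in(0,\infty):|\delta_x|\le a\,\kappa^{1/2}\}$. (i) Uniformly for $x\in B_{\mu,\kappa}(\eta)$, one has, as $\kappa\to\infty$, $$\log\left\{\frac{\sqrt{2}\,\nu_\kappa f_{\mu,\kappa}(x)}{\phi(\widetilde{\delta}_x)}\right\}=\frac{1}{\kappa}\left(\frac{\widetilde{\delta}_x^4}{24}-\frac{\widetilde{\delta}_x^2}{8}\right)+\frac{1}{\kappa^2}\left(-\frac{\widetilde{\delta}_x^6}{720}+\frac{\widetilde{\delta}_x^4}{48}-\frac{\widetilde{\delta}_x^2}{8}+\frac{3}{64}\right)+\mathcal{O}_{\eta}\left(\frac{1+|\widetilde{\delta}_x|^8}{\kappa^3}\right).$$ (ii) Moreover, given $\widetilde{\eta}\in(0,\infty)$, uniformly for $x\in B_{\mu,\kappa}(\kappa^{-1/4}\widetilde{\eta})$, one has, as $\kappa\to\infty$, $$\frac{\sqrt{2}\,\nu_\kappa f_{\mu,\kappa}(x)}{\phi(\widetilde{\delta}_x)}=1+\frac{1}{\kappa}\left(\frac{\widetilde{\delta}_x^4}{24}-\frac{\widetilde{\delta}_x^2}{8}\right)+\frac{1}{\kappa^2}\left(\frac{\widetilde{\delta}_x^8}{1152}-\frac{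19\,\widetilde{\delta}_x^6}{2880}+\frac{11\,\widetilde{\delta}_x^4}{384}-\frac{\widetilde{\delta}_x^2}{8}+\frac{3}{64}\right)+\mathcal{O}_{\widetilde{\eta}}\left(\frac{1+|\widetilde{\delta}_x|^{12}}{\kappa^3}\right).$$
   Context: $I_\nu$ is the modified Bessel function of the first kind of order $\nu\in\{0,1,\ldots\}$. For $\kappa\in(0,\infty)$, $\nu_\kappa>0$ is defined by $\nu_\kappa^2=1-I_1(\kappa)/I_0(\kappa)$ (the circular variance of the von Mises distribution), so $\delta_x=(x-\mu)/\nu_\kappa$. The von Mises$(\mu,\kappa)$ density is given by the formula $f_{\mu,\kappa}(x)=\exp\{\kappa\cos(x-\mu)\}/(2\pi I_0(\kappa))$, evaluated at any real $x$. The standard normal density is $\phi(z)=\exp(-z^2/2)/\sqrt{2\pi}$. The notation $u=\mathcal{O}_{c}(v)$ as $\kappa\to\infty$ means $\limsup_{\kappa\to\infty}|u/v|\le C$ for some constant $C\in(0,\infty)$ that may depend only on the parameter $c$. "Uniformly for $x\in B$" (where $B$ may depend on $\kappa$) means that, for all sufficiently large $\kappa$, the remainder is bounded by $C$ times the indicated quantity simultaneously for all $x\in B$, with the same $C$. *)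

theory Defs
  imports "HOL-Probability.Distributions"
begin

definition bessel_I :: "nat \<Rightarrow> real \<Rightarrow> real" where
  "bessel_I n x = (\<Sum>m. (x / 2) ^ (2 * m + n) / (fact m * fact (m + n)))"

(* Square root of the circular variance of the von Mises distribution. *)
definition vm_nu :: "real \<Rightarrow> real" where
  "vm_nu \<kappa> = sqrt (1 - bessel_I 1 \<kappa> / bessel_I 0 \<kappa>)"

(* The density formula is evaluated at every real x, without reduction modulo 2 pi. *)
definition vm_density :: "real \<Rightarrow> real \<Rightarrow> real \<Rightarrow> real" where
  "vm_density \<mu> \<kappa> x = exp (\<kappa> * cos (x - \<mu>)) / (2 * pi * bessel_I 0 \<kappa>)"

definition vm_delta :: "real \<Rightarrow> real \<Rightarrow> real \<Rightarrow> real" where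
  "vm_delta \<mu> \<kappa> x = (x - \<mu>) / vm_nu \<kappa>"

definition vm_delta_tilde :: "real \<Rightarrow> real \<Rightarrow> real \<Rightarrow> real" where
  "vm_delta_tilde \<mu> \<kappa> x = vm_delta \<mu> \<kappa> x / sqrt 2"

definition vm_bulk :: "real \<Rightarrow> real \<Rightarrow> real \<Rightarrow> real set" where
  "vm_bulk \<mu> \<kappa> a = {x. 0 < x \<and> \<bar>vm_delta \<mu> \<kappa> x\<bar> \<le> a * \<kappa> powr (1 / 2)}"

definition vm_ratio :: "real \<Rightarrow> real \<Rightarrow> real \<Rightarrow> real" where
  "vm_ratio \<mu> \<kappa> x =
     sqrt 2 * vm_nu \<kappa> * vm_density \<mu> \<kappa> x / std_normal_density (vm_delta_tilde \<mu> \<kappa> x)"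

(* For a family of problems indexed by p (here p is the location parameter):
   u = O(v) as kappa tends to infinity, uniformly for x in B p kappa, with one constant C that
   serves all p. Only the threshold for kappa may depend on p. *)
definition unif_bigo ::
    "('p \<Rightarrow> real \<Rightarrow> 'a set) \<Rightarrow> ('p \<Rightarrow> real \<Rightarrow> 'a \<Rightarrow> real) \<Rightarrow> ('p \<Rightarrow> real \<Rightarrow> 'a \<Rightarrow> real) \<Rightarrow> bool" where
  "unif_bigo B u v \<longleftrightarrow>
     (\<exists>C>0. \<forall>p. \<forall>\<^sub>F \<kappa> in at_top. \<forall>x\<in>B p \<kappa>. \<bar>u p \<kappa> x\<bar> \<le> C * \<bar>v p \<kappa> x\<bar>)"

end

theory Submission
  imports Defs "HOL-Real_Asymp.Real_Asymp"
begin

text \<open>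
  Write \<open>d\<close> for the standardised variable \<open>vm_delta_tilde\<close> and \<open>A = 2 \<kappa> \<nu>\<^sup>2\<close>, so that \<open>(x - \<mu>)\<^sup>2 = A d\<^sup>2 / \<kappa>\<close>. Then
  \<open>ln vm_ratio = (ln A) / 2 - ln (sqrt (2 \<pi> \<kappa>) exp (-\<kappa>) I\<^sub>0(\<kappa>)) + \<kappa> (cos (x - \<mu>) - 1) + d\<^sup>2 / 2\<close>
  exactly (\<open>vm_ratio_exact\<close>). So three expansions are enough: that of the circular variance up to \<open>O(\<kappa>\<^sup>-\<^sup>4)\<close>, that of
  \<open>ln I\<^sub>0\<close> up to \<open>O(\<kappa>\<^sup>-\<^sup>3)\<close>, and the Taylor polynomial of the cosine with remainder \<open>y\<^sup>8 / 8!\<close>.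

  The Bessel asymptotics come from the differential equation and not from an integral representation. The circular
  variance \<open>q = 1 - I\<^sub>1/I\<^sub>0\<close> solves the Riccati equation \<open>q' = (1 - q)/\<kappa> - 2 q + q\<^sup>2\<close>, which is contracting as long as
  \<open>q < 1\<close>; hence a truncated formal solution is close to \<open>q\<close> to the order of its residual (\<open>circ_var_asymptotics\<close>).
  Since \<open>(ln I\<^sub>0)' = 1 - q\<close>, integration from infinity gives the expansion of \<open>ln I\<^sub>0\<close> (\<open>ln_bessel_I0_asymptotics\<close>), once
  the constant of integration is known. That constant is the limit of \<open>2 \<pi> \<kappa> exp (-2\<kappa>) I\<^sub>0(\<kappa>)\<^sup>2\<close>, namely 1
  (\<open>bessel_I0_limit\<close>). The coefficients of the power series of \<open>I\<^sub>0\<^sup>2\<close> are squared normalised central binomial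
  coefficients times those of \<open>cosh (2\<kappa>)\<close>, and the Wallis product bounds them so sharply that \<open>I\<^sub>0\<^sup>2 \<ge> sinh (2\<kappa>) / (\<pi> \<kappa>)\<close> and
  \<open>I\<^sub>0 I\<^sub>1 \<le> (cosh (2\<kappa>) - 1) / (\<pi> \<kappa>)\<close>.

  Collecting terms, the logarithmic expansion holds with one constant for all real \<open>x\<close> (\<open>vm_log_expansion\<close>). For the
  ratio itself one exponentiates. This costs a constant depending on an upper bound of \<open>(1 + d\<^sup>4) / \<kappa>\<close>, and such a bound
  is what the shrinking bulk provides (\<open>exp_vm_log_main\<close>, \<open>vm_bulk_quartic_bound\<close>).
\<close>

section \<open>The Bessel functions as power series\<close>

text \<open>
  The entire function with \<open>I\<^sub>n(x) = (x/2)\<^sup>n bessel_core n (x\<^sup>2/4)\<close>. Its coefficients have no parity gaps, and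
  differentiation just raises the index, so all Bessel identities become coefficient identities.
\<close>

definition bessel_core :: "nat \<Rightarrow> real \<Rightarrow> real" where
  "bessel_core n y = (\<Sum>m. 1 / (fact m * fact (m + n)) * y ^ m)"

lemma summable_bessel_core: "summable (\<lambda>m. 1 / (fact m * fact (m + n)) * (y::real) ^ m)"
proof (rule summable_comparison_test'[where N = 0])
  show "summable (\<lambda>m. inverse (fact m) * \<bar>y\<bar> ^ m)"
    by (rule summable_exp)
  show "norm (1 / (fact m * fact (m + n)) * y ^ m) \<le> inverse (fact m) * \<bar>y\<bar> ^ m" for m
  proof -
    have "1 / (fact m * fact (m + n)) \<le> inverse (fact m :: real)"
      using fact_ge_1[of "m + n", where 'a = real] by (simp add: field_simps)
    from mult_right_mono[OF this, of "\<bar>y\<bar> ^ m"] show ?thesis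
      by (simp add: abs_mult power_abs)
  qed
qed

lemma bessel_core_pos: "0 \<le> y \<Longrightarrow> 0 < bessel_core n y"
  unfolding bessel_core_def by (rule suminf_pos2[OF summable_bessel_core, where i = 0]) auto

lemma DERIV_bessel_core: "(bessel_core n has_real_derivative bessel_core (Suc n) y) (at y)"
proof -
  have "diffs (\<lambda>m. 1 / (fact m * fact (m + n))) = (\<lambda>m. 1 / (fact m * fact (m + Suc n)) :: real)"
    by (simp add: diffs_def fun_eq_iff field_simps del: of_nat_Suc)
  with termdiffs_strong_converges_everywhere[OF summable_bessel_core, of n y]
  show ?thesis by (simp add: bessel_core_def[abs_def])
qed

text \<open>
  Compare coefficients: \<open>m + n + 1 = (n + 1) + m\<close> splits \<open>1/(m! (m+n)!)\<close> into the two terms on the right.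
  This is the three-term recurrence of the \<open>I\<^sub>n\<close>, and it yields the derivative of \<open>I\<^sub>1\<close> below.
\<close>

lemma bessel_core_contiguous:
  "bessel_core n y = real (Suc n) * bessel_core (Suc n) y + y * bessel_core (Suc (Suc n)) y"
proof -
  have "(\<lambda>m. real (Suc m) / (fact (Suc m) * fact (Suc m + Suc n)) * y ^ Suc m) sums
          (y * bessel_core (Suc (Suc n)) y)"
    using sums_mult[OF summable_sums[OF summable_bessel_core[of "Suc (Suc n)" y]], of y]
    unfolding bessel_core_def
    by (rule sums_cong[THEN iffD1, rotated]) (simp add: field_simps del: of_nat_Suc)
  then have "(\<lambda>m. real m / (fact m * fact (m + Suc n)) * y ^ m) sums
               (y * bessel_core (Suc (Suc n)) y)"
    by (subst (asm) sums_Suc_iff) simp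
  from sums_add[OF sums_mult[OF summable_sums[OF summable_bessel_core[of "Suc n" y]], of "real (Suc n)"] this]
  have "(\<lambda>m. 1 / (fact m * fact (m + n)) * y ^ m) sums
     (real (Suc n) * bessel_core (Suc n) y + y * bessel_core (Suc (Suc n)) y)"
    unfolding bessel_core_def
    by (rule sums_cong[THEN iffD1, rotated]) (simp add: divide_simps, simp add: algebra_simps)
  then show ?thesis
    unfolding bessel_core_def[of n] by (simp add: sums_iff)
qed

lemma bessel_I_core: "bessel_I n x = (x / 2) ^ n * bessel_core n (x\<^sup>2 / 4)"
proof -
  have "(x / 2) ^ n * bessel_core n (x\<^sup>2 / 4)
      = (\<Sum>m. (x / 2) ^ n * (1 / (fact m * fact (m + n)) * (x\<^sup>2 / 4) ^ m))"
    unfolding bessel_core_def by (rule suminf_mult[symmetric, OF summable_bessel_core])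
  also have "\<dots> = bessel_I n x"
    unfolding bessel_I_def
  proof (rule suminf_cong)
    fix m
    have "(x\<^sup>2 / 4) ^ m = (x / 2) ^ (2 * m)"
      by (simp add: power_mult power_divide)
    then show "(x / 2) ^ n * (1 / (fact m * fact (m + n)) * (x\<^sup>2 / 4) ^ m)
        = (x / 2) ^ (2 * m + n) / (fact m * fact (m + n))"
      by (simp only: power_add) (simp add: mult_ac)
  qed
  finally show ?thesis ..
qed

lemma bessel_I_pos: "0 < x \<Longrightarrow> 0 < bessel_I n x"
  by (simp add: bessel_I_core bessel_core_pos)

lemma DERIV_bessel_I0: "(bessel_I 0 has_real_derivative bessel_I 1 x) (at x)"
proof -
  have "((\<lambda>x. bessel_core 0 (x\<^sup>2 / 4)) has_real_derivative bessel_core (Suc 0) (x\<^sup>2 / 4) * (x / 2)) (at x)"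
    by (rule DERIV_chain2[OF DERIV_bessel_core]) (auto intro!: derivative_eq_intros)
  then show ?thesis
    by (simp add: bessel_I_core[abs_def] mult.commute)
qed

lemma DERIV_bessel_I1:
  assumes "x \<noteq> 0"
  shows "(bessel_I 1 has_real_derivative bessel_I 0 x - bessel_I 1 x / x) (at x)"
proof -
  have "((\<lambda>x. bessel_core 1 (x\<^sup>2 / 4)) has_real_derivative bessel_core (Suc 1) (x\<^sup>2 / 4) * (x / 2)) (at x)"
    by (rule DERIV_chain2[OF DERIV_bessel_core]) (auto intro!: derivative_eq_intros)
  then have "((\<lambda>x. x / 2 * bessel_core 1 (x\<^sup>2 / 4)) has_real_derivative
      bessel_core 1 (x\<^sup>2 / 4) / 2 + x / 2 * (bessel_core (Suc 1) (x\<^sup>2 / 4) * (x / 2))) (at x)"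
    by (auto intro!: derivative_eq_intros)
  moreover have "bessel_core 1 (x\<^sup>2 / 4) / 2 + x / 2 * (bessel_core (Suc 1) (x\<^sup>2 / 4) * (x / 2))
     = bessel_I 0 x - bessel_I 1 x / x"
    using bessel_core_contiguous[of 0 "x\<^sup>2 / 4"] assms
    by (simp add: bessel_I_core field_simps power2_eq_square)
  ultimately show ?thesis
    by (simp add: bessel_I_core[abs_def])
qed

section \<open>Wallis bounds for central binomial coefficients\<close>

text \<open>
  The square of \<open>C(2m,m)/4\<^sup>m\<close>. The square is what appears in the coefficients of \<open>I\<^sub>0\<^sup>2\<close>, and
  \<open>wallis_ratio n * (2n+1)\<close> is the reciprocal of the \<open>n\<close>-th partial Wallis product.
\<close>

definition wallis_ratio :: "nat \<Rightarrow> real" where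
  "wallis_ratio m = (real ((2 * m) choose m) / 4 ^ m)\<^sup>2"

lemma central_binomial_Suc:
  "real (Suc m) * real ((2 * Suc m) choose Suc m) = 2 * real (2 * m + 1) * real ((2 * m) choose m)"
proof -
  have 1: "Suc m * ((2 * Suc m) choose Suc m) = (2 * Suc m) * ((2 * m + 1) choose m)"
    using Suc_times_binomial_eq[of "2 * m + 1" m] by (simp add: mult_ac)
  have 2: "Suc m * ((2 * m + 1) choose Suc m) = (2 * m + 1) * ((2 * m) choose m)"
    using Suc_times_binomial_eq[of "2 * m" m] by (simp add: mult_ac)
  have 3: "(2 * m + 1) choose Suc m = (2 * m + 1) choose m"
    using binomial_symmetric[of m "2 * m + 1"] by simp
  have "Suc m * ((2 * Suc m) choose Suc m) = 2 * ((2 * m + 1) * ((2 * m) choose m))"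
    using 1 2 3 by (simp only: mult.assoc)
  then have "real (Suc m * ((2 * Suc m) choose Suc m)) = real (2 * ((2 * m + 1) * ((2 * m) choose m)))"
    by (rule arg_cong)
  then show ?thesis by (simp only: of_nat_mult of_nat_numeral mult_ac)
qed

lemma wallis_ratio_Suc:
  "wallis_ratio (Suc m) = ((2 * real m + 1) / (2 * real m + 2))\<^sup>2 * wallis_ratio m"
proof -
  have "B / (4 * c) = (2 * M + 1) / (2 * M + 2) * (b / c)"
    if "(M + 1) * B = 2 * (2 * M + 1) * b" "0 \<le> M" for B M b c :: real
    using that by (simp add: divide_simps) (simp add: algebra_simps)
  from this[of "real m", OF _ of_nat_0_le_iff] central_binomial_Suc[of m]
  have "real ((2 * Suc m) choose Suc m) / 4 ^ Suc m = (2 * real m + 1) / (2 * real m + 2) * (real ((2 * m) choose m) / 4 ^ m)"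
    by (simp only: power_Suc of_nat_Suc of_nat_add of_nat_mult of_nat_numeral of_nat_1 add.commute)
  then show ?thesis
    unfolding wallis_ratio_def by (simp only: power_mult_distrib)
qed

lemma wallis_ratio_pos: "0 < wallis_ratio m"
  unfolding wallis_ratio_def by simp

lemma wallis_ratio_prod:
  "wallis_ratio n * (2 * real n + 1) = inverse (\<Prod>k=1..n. (4 * real k ^ 2) / (4 * real k ^ 2 - 1))"
proof (induction n)
  case 0
  show ?case by (simp add: wallis_ratio_def)
next
  case (Suc n)
  have *: "4 * real (Suc n) ^ 2 - 1 = (2 * real n + 1) * (2 * real n + 3)"
    by (simp add: power2_eq_square algebra_simps)
  have "wallis_ratio (Suc n) * (2 * real (Suc n) + 1) =
     wallis_ratio n * (2 * real n + 1) * inverse ((4 * real (Suc n) ^ 2) / (4 * real (Suc n) ^ 2 - 1))"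
    unfolding * wallis_ratio_Suc by (simp add: divide_simps power2_eq_square) (simp add: algebra_simps)
  with Suc show ?case by (simp add: inverse_eq_divide)
qed

lemma wallis_ratio_limit: "(\<lambda>n. wallis_ratio n * (2 * real n + 1)) \<longlonglongrightarrow> 2 / pi"
  using tendsto_inverse[OF wallis] by (simp add: wallis_ratio_prod)

text \<open>
  The Wallis product increases, so the normalisation by \<open>2n+1\<close> decreases to its limit, while the
  normalisation by \<open>2n\<close> in the next lemma increases to the same limit. These two-sided bounds are precise
  enough for the leading term of \<open>I\<^sub>0\<close>.
\<close>

lemma wallis_ratio_lower: "2 / (pi * (2 * real n + 1)) \<le> wallis_ratio n"
proof -
  have "decseq (\<lambda>n. wallis_ratio n * (2 * real n + 1))"
  proof (rule decseq_SucI)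
    fix n
    have "wallis_ratio (Suc n) * (2 * real (Suc n) + 1)
       = wallis_ratio n * (2 * real n + 1) * ((2 * real n + 1) * (2 * real n + 3) / (2 * real n + 2)\<^sup>2)"
      unfolding wallis_ratio_Suc by (simp add: power_divide power2_eq_square algebra_simps)
    also have "\<dots> \<le> wallis_ratio n * (2 * real n + 1) * 1"
      using wallis_ratio_pos[of n]
      by (intro mult_left_mono)
         (auto simp: power2_eq_square algebra_simps intro!: divide_le_eq_1_pos[THEN iffD2] add_pos_nonneg)
    finally show "wallis_ratio (Suc n) * (2 * real (Suc n) + 1) \<le> wallis_ratio n * (2 * real n + 1)" by simp
  qed
  from decseq_ge[OF this wallis_ratio_limit, of n]
  have "2 / pi / (2 * real n + 1) \<le> wallis_ratio n"
    by (subst pos_divide_le_eq) auto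
  then show ?thesis by simp
qed

lemma wallis_ratio_upper: "0 < n \<Longrightarrow> wallis_ratio n \<le> 1 / (pi * real n)"
proof -
  assume n: "0 < n"
  have "incseq (\<lambda>n. wallis_ratio n * (2 * real n))"
  proof (rule incseq_SucI)
    fix n
    have "wallis_ratio n * (2 * real n) * 1 \<le> wallis_ratio n * ((2 * real n + 1)\<^sup>2 / (2 * real n + 2))"
      using wallis_ratio_pos[of n] unfolding mult.assoc
      by (intro mult_left_mono) (auto simp: field_simps power2_eq_square)
    also have "\<dots> = wallis_ratio (Suc n) * (2 * real (Suc n))"
      unfolding wallis_ratio_Suc by (simp add: divide_simps power2_eq_square)
    finally show "wallis_ratio n * (2 * real n) \<le> wallis_ratio (Suc n) * (2 * real (Suc n))" by simp
  qed
  moreover have "(\<lambda>n. wallis_ratio n * (2 * real n)) \<longlonglongrightarrow> 2 / pi"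
  proof -
    have "(\<lambda>n. 2 * real n / (2 * real n + 1)) \<longlonglongrightarrow> 1"
      by real_asymp
    from tendsto_mult[OF wallis_ratio_limit this] show ?thesis
      by (simp add: mult.assoc add_pos_nonneg[THEN less_imp_neq, THEN not_sym])
  qed
  ultimately have "wallis_ratio n * (2 * real n) \<le> 2 / pi"
    by (rule incseq_le)
  then show ?thesis using n by (simp add: field_simps)
qed

section \<open>Bounds for products of Bessel functions\<close>

text \<open>
  Squaring the series and using \<open>(\<Sum>i\<le>m. C(m,i)\<^sup>2) = C(2m,m)\<close> gives coefficients that differ from those
  of a hyperbolic cosine of \<open>2x\<close> (with \<open>16 y = (2x)\<^sup>2\<close>) only by the Wallis factor.
\<close>

lemma bessel_core_0_square_sums:
  "(\<lambda>m. wallis_ratio m * (16 * y) ^ m / fact (2 * m)) sums (bessel_core 0 y)\<^sup>2"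
proof -
  let ?a = "\<lambda>m. 1 / (fact m * fact (m + 0)) * y ^ m"
  have "summable (\<lambda>m. norm (?a m))"
    using summable_bessel_core[of 0 "\<bar>y\<bar>"] by (simp add: abs_mult power_abs)
  from Cauchy_product_sums[OF this this]
  have "(\<lambda>m. \<Sum>i\<le>m. ?a i * ?a (m - i)) sums (bessel_core 0 y)\<^sup>2"
    by (simp add: bessel_core_def power2_eq_square)
  moreover have "(\<Sum>i\<le>m. ?a i * ?a (m - i)) = wallis_ratio m * (16 * y) ^ m / fact (2 * m)" for m
  proof -
    have "(\<Sum>i\<le>m. ?a i * ?a (m - i)) = (\<Sum>i\<le>m. real ((m choose i)\<^sup>2) * (y ^ m / (fact m)\<^sup>2))"
    proof (rule sum.cong[OF refl])
      fix i assume "i \<in> {..m}"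
      then have "i \<le> m" by simp
      then have "real (m choose i) = fact m / (fact i * fact (m - i))" "y ^ m = y ^ i * y ^ (m - i)"
        by (simp_all add: binomial_fact power_add[symmetric])
      then show "?a i * ?a (m - i) = real ((m choose i)\<^sup>2) * (y ^ m / (fact m)\<^sup>2)"
        by (simp add: power2_eq_square)
    qed
    also have "\<dots> = real ((2 * m) choose m) * (y ^ m / (fact m)\<^sup>2)"
      by (simp only: sum_distrib_right[symmetric] of_nat_sum[symmetric] choose_square_sum)
    also have "\<dots> = wallis_ratio m * (16 * y) ^ m / fact (2 * m)"
    proof -
      have "real ((2 * m) choose m) = fact (2 * m) / (fact m * fact m)"
        by (simp add: binomial_fact)
      moreover have "(16::real) ^ m = (4 ^ m)\<^sup>2"
        by (simp add: power2_eq_square power_mult_distrib[symmetric])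
      ultimately show ?thesis
        by (simp add: wallis_ratio_def power_mult_distrib power_divide field_simps power2_eq_square)
    qed
    finally show ?thesis .
  qed
  ultimately show ?thesis by simp
qed

lemma cosh_sums_even: "(\<lambda>m. (x\<^sup>2) ^ m / fact (2 * m)) sums cosh (x::real)"
proof -
  have "(\<lambda>n. (\<lambda>n. if even n then x ^ n /\<^sub>R fact n else 0) (2 * n)) sums cosh x"
    by (subst sums_mono_reindex) (auto simp: strict_mono_def cosh_converges elim!: evenE)
  moreover have "x ^ (2 * m) = (x\<^sup>2) ^ m" for m
    by (rule power_mult)
  ultimately show ?thesis
    by (simp add: divide_inverse_commute)
qed

lemma sinh_sums_odd: "(\<lambda>m. x * (x\<^sup>2) ^ m / fact (2 * m + 1)) sums sinh (x::real)"
proof -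
  have "(\<lambda>n. (\<lambda>n. if even n then 0 else x ^ n /\<^sub>R fact n) (2 * n + 1)) sums sinh x"
    by (subst sums_mono_reindex) (auto simp: strict_mono_def sinh_converges elim!: oddE)
  moreover have "x ^ (2 * m + 1) = x * (x\<^sup>2) ^ m" for m
    by (simp add: power_mult)
  ultimately show ?thesis
    by (simp add: divide_inverse_commute del: fact_Suc power_Suc)
qed

text \<open>
  With the lower Wallis bound the factor \<open>1/(2m+1)\<close> turns \<open>1/(2m)!\<close> into \<open>1/(2m+1)!\<close>, so the minorant is
  exactly the series of \<open>sinh\<close>.
\<close>

lemma bessel_I0_square_lower:
  assumes "0 < x"
  shows "sinh (2 * x) / (pi * x) \<le> (bessel_I 0 x)\<^sup>2"
proof -
  have *: "(\<lambda>m. wallis_ratio m * ((2 * x)\<^sup>2) ^ m / fact (2 * m)) sums (bessel_I 0 x)\<^sup>2"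
    using bessel_core_0_square_sums[of "x\<^sup>2 / 4"] by (simp add: bessel_I_core power_mult_distrib)
  have "(\<lambda>m. 1 / (pi * x) * (2 * x * ((2 * x)\<^sup>2) ^ m / fact (2 * m + 1))) sums
          (1 / (pi * x) * sinh (2 * x))"
    by (rule sums_mult[OF sinh_sums_odd])
  then have "1 / (pi * x) * sinh (2 * x) \<le> (bessel_I 0 x)\<^sup>2"
  proof (rule sums_le[rotated 1, OF _ *])
    fix m
    have "1 / (pi * x) * (2 * x * ((2 * x)\<^sup>2) ^ m / fact (2 * m + 1))
        = 2 / (pi * (2 * real m + 1)) * (((2 * x)\<^sup>2) ^ m / fact (2 * m))"
      using assms by (simp add: divide_simps)
    also have "\<dots> \<le> wallis_ratio m * (((2 * x)\<^sup>2) ^ m / fact (2 * m))"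
      by (intro mult_right_mono wallis_ratio_lower) simp
    finally show "1 / (pi * x) * (2 * x * ((2 * x)\<^sup>2) ^ m / fact (2 * m + 1))
        \<le> wallis_ratio m * ((2 * x)\<^sup>2) ^ m / fact (2 * m)" by simp
  qed
  then show ?thesis by simp
qed

text \<open>
  The upper Wallis bound has the factor \<open>1/m\<close>, which is what differentiation cancels. Hence the clean majorant
  is one for \<open>(I\<^sub>0\<^sup>2)' = 2 I\<^sub>0 I\<^sub>1\<close> and not for \<open>I\<^sub>0\<^sup>2\<close> itself. Since \<open>I\<^sub>1/I\<^sub>0\<close> tends to 1, the two bounds together still
  determine \<open>I\<^sub>0\<close> to leading order.
\<close>

lemma bessel_I0_I1_upper:
  assumes "0 < x"
  shows "bessel_I 0 x * bessel_I 1 x \<le> (cosh (2 * x) - 1) / (pi * x)"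
proof -
  let ?y = "x\<^sup>2 / 4"
  let ?c = "\<lambda>m. wallis_ratio m * 16 ^ m / fact (2 * m)"
  have "(\<lambda>m. diffs ?c m * ?y ^ m) sums (2 * bessel_core 0 ?y * bessel_core 1 ?y)"
  proof (rule termdiffs_sums_strong)
    show "(\<lambda>m. ?c m * z ^ m) sums (bessel_core 0 z)\<^sup>2" for z
      using bessel_core_0_square_sums[of z] by (simp add: power_mult_distrib mult_ac)
    show "((\<lambda>z. (bessel_core 0 z)\<^sup>2) has_real_derivative 2 * bessel_core 0 ?y * bessel_core 1 ?y) (at ?y)"
      by (rule derivative_eq_intros DERIV_bessel_core refl)+ simp
    show "norm ?y < norm ?y + 1" by simp
  qed
  from sums_mult[OF this, of "x / 4"]
  have *: "(\<lambda>m. x / 4 * (diffs ?c m * ?y ^ m)) sums (bessel_I 0 x * bessel_I 1 x)"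
    by (rule back_subst[where P = "(sums) _"]) (simp add: bessel_I_core)
  have "(\<lambda>m. ((2 * x)\<^sup>2) ^ Suc m / fact (2 * Suc m)) sums (cosh (2 * x) - 1)"
    using cosh_sums_even[of "2 * x"] by (subst sums_Suc_iff) simp
  from sums_mult[OF this, of "1 / (pi * x)"]
  have **: "(\<lambda>m. 1 / (pi * x) * (((2 * x)\<^sup>2) ^ Suc m / fact (2 * Suc m))) sums
     (1 / (pi * x) * (cosh (2 * x) - 1))" .
  have "bessel_I 0 x * bessel_I 1 x \<le> 1 / (pi * x) * (cosh (2 * x) - 1)"
  proof (rule sums_le[rotated 1, OF * **])
    fix m
    define F :: real where "F = fact (2 * Suc m)"
    have F: "F > 0" by (simp add: F_def)
    have pw: "16 ^ Suc m * ?y ^ m = 16 * ((2 * x)\<^sup>2) ^ m"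
    proof -
      have "16 ^ m * ?y ^ m = (16 * ?y) ^ m" by (rule power_mult_distrib[symmetric])
      also have "16 * ?y = (2 * x)\<^sup>2" by (simp add: power2_eq_square)
      finally show ?thesis by simp
    qed
    have "x / 4 * (diffs ?c m * ?y ^ m)
        = wallis_ratio (Suc m) * (x / 4 * real (Suc m) * (16 ^ Suc m * ?y ^ m) / F)"
      unfolding diffs_def F_def[symmetric] by (simp add: mult_ac)
    also have "\<dots> = wallis_ratio (Suc m) * (4 * x * real (Suc m) * ((2 * x)\<^sup>2) ^ m / F)"
      unfolding pw by simp
    also have "\<dots> \<le> 1 / (pi * real (Suc m)) * (4 * x * real (Suc m) * ((2 * x)\<^sup>2) ^ m / F)"
      using assms F by (intro mult_right_mono wallis_ratio_upper) auto
    also have "\<dots> \<le> 1 / (pi * x) * (((2 * x)\<^sup>2) ^ Suc m / F)"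
      using assms F by (simp add: divide_simps power2_eq_square del: of_nat_Suc)
    finally show "x / 4 * (diffs ?c m * ?y ^ m) \<le> 1 / (pi * x) * (((2 * x)\<^sup>2) ^ Suc m / fact (2 * Suc m))"
      unfolding F_def .
  qed
  then show ?thesis by simp
qed

section \<open>The circular variance and its Riccati equation\<close>

definition circ_var :: "real \<Rightarrow> real" where
  "circ_var \<kappa> = 1 - bessel_I 1 \<kappa> / bessel_I 0 \<kappa>"

lemma circ_var_less_1: "0 < \<kappa> \<Longrightarrow> circ_var \<kappa> < 1"
  by (simp add: circ_var_def bessel_I_pos)

text \<open>
  The first-order system \<open>I\<^sub>0' = I\<^sub>1\<close>, \<open>I\<^sub>1' = I\<^sub>0 - I\<^sub>1/x\<close> makes the quotient \<open>I\<^sub>1/I\<^sub>0\<close>, and hence its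
  complement, solve a scalar equation that does not mention the Bessel functions any more.
\<close>

lemma circ_var_riccati:
  assumes "0 < \<kappa>"
  shows "(circ_var has_real_derivative
           (1 - circ_var \<kappa>) / \<kappa> - 2 * circ_var \<kappa> + (circ_var \<kappa>)\<^sup>2) (at \<kappa>)"
proof -
  have pos: "bessel_I 0 \<kappa> > 0" using assms by (rule bessel_I_pos)
  have "((\<lambda>\<kappa>. 1 - bessel_I 1 \<kappa> / bessel_I 0 \<kappa>) has_real_derivative
          0 - ((bessel_I 0 \<kappa> - bessel_I 1 \<kappa> / \<kappa>) * bessel_I 0 \<kappa> - bessel_I 1 \<kappa> * bessel_I 1 \<kappa>)
               / (bessel_I 0 \<kappa> * bessel_I 0 \<kappa>)) (at \<kappa>)"
    using pos assms by (intro DERIV_diff DERIV_const DERIV_divide DERIV_bessel_I0 DERIV_bessel_I1) auto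
  moreover have "0 - ((bessel_I 0 \<kappa> - bessel_I 1 \<kappa> / \<kappa>) * bessel_I 0 \<kappa> - bessel_I 1 \<kappa> * bessel_I 1 \<kappa>)
               / (bessel_I 0 \<kappa> * bessel_I 0 \<kappa>)
     = (1 - circ_var \<kappa>) / \<kappa> - 2 * circ_var \<kappa> + (circ_var \<kappa>)\<^sup>2"
    using pos assms by (simp add: circ_var_def field_simps power2_eq_square)
  ultimately show ?thesis by (simp add: circ_var_def[abs_def])
qed

text \<open>
  The formal solution of the Riccati equation in powers of \<open>1/\<kappa>\<close>, up to the third power.
\<close>

definition circ_var_approx :: "real \<Rightarrow> real" where
  "circ_var_approx \<kappa> = 1 / (2 * \<kappa>) + 1 / (8 * \<kappa> ^ 2) + 1 / (8 * \<kappa> ^ 3)"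

text \<open>
  The coefficients of the approximation are chosen so that the residual of the equation starts at order
  \<open>\<kappa>\<^sup>-\<^sup>4\<close>.
\<close>

lemma circ_var_approx_riccati:
  assumes "0 < \<kappa>"
  defines "p \<equiv> circ_var_approx \<kappa>"
  shows "(circ_var_approx has_real_derivative
     (1 - p) / \<kappa> - 2 * p + p\<^sup>2 - (25 / 64 / \<kappa> ^ 4 + 1 / 32 / \<kappa> ^ 5 + 1 / 64 / \<kappa> ^ 6)) (at \<kappa>)"
proof -
  have "(circ_var_approx has_real_derivative
      - 1 / (2 * \<kappa> ^ 2) - 1 / (4 * \<kappa> ^ 3) - 3 / (8 * \<kappa> ^ 4)) (at \<kappa>)"
    unfolding circ_var_approx_def[abs_def] using assms(1)
    by (auto intro!: derivative_eq_intros simp: field_simps eval_nat_numeral)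
  moreover have "- 1 / (2 * \<kappa> ^ 2) - 1 / (4 * \<kappa> ^ 3) - 3 / (8 * \<kappa> ^ 4)
     = (1 - p) / \<kappa> - 2 * p + p\<^sup>2 - (25 / 64 / \<kappa> ^ 4 + 1 / 32 / \<kappa> ^ 5 + 1 / 64 / \<kappa> ^ 6)"
    unfolding p_def circ_var_approx_def using assms(1)
    by (simp add: field_simps eval_nat_numeral)
  ultimately show ?thesis by simp
qed

text \<open>
  The error \<open>e\<close> satisfies \<open>e' = \<rho> - a e\<close> with \<open>\<rho> = O(\<kappa>\<^sup>-\<^sup>4)\<close>, and \<open>a \<ge> 1\<close> because the circular
  variance is below 1. The equation is therefore contracting, and the error inherits the size of its forcing \<open>\<rho>\<close>:
  \<open>exp \<kappa> * (e\<^sup>2 - 2 \<kappa>\<^sup>-\<^sup>8)\<close> decreases for \<open>\<kappa> \<ge> 16\<close>, so \<open>e\<^sup>2\<close> exceeds \<open>2 \<kappa>\<^sup>-\<^sup>8\<close> by an exponentially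
  small amount at most.
\<close>

lemma circ_var_asymptotics:
  "\<forall>\<^sub>F \<kappa> in at_top. \<bar>circ_var \<kappa> - circ_var_approx \<kappa>\<bar> \<le> 2 / \<kappa> ^ 4"
proof -
  define e where "e = (\<lambda>\<kappa>. circ_var \<kappa> - circ_var_approx \<kappa>)"
  define a where "a = (\<lambda>\<kappa>. 2 + 1 / \<kappa> - circ_var \<kappa> - circ_var_approx \<kappa>)"
  define \<rho> :: "real \<Rightarrow> real" where "\<rho> = (\<lambda>\<kappa>. 25 / 64 / \<kappa> ^ 4 + 1 / 32 / \<kappa> ^ 5 + 1 / 64 / \<kappa> ^ 6)"
  define \<Phi> where "\<Phi> = (\<lambda>\<kappa>. exp \<kappa> * ((e \<kappa>)\<^sup>2 - 2 / \<kappa> ^ 8))"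
  have e_deriv: "(e has_real_derivative \<rho> \<kappa> - a \<kappa> * e \<kappa>) (at \<kappa>)" if "0 < \<kappa>" for \<kappa>
    unfolding e_def using that
    by (auto intro!: derivative_eq_intros circ_var_riccati circ_var_approx_riccati
             simp: a_def \<rho>_def field_simps power2_eq_square)
  have a_ge: "1 \<le> a \<kappa>" if "1 \<le> \<kappa>" for \<kappa>
  proof -
    define u v w where "u = 1 / \<kappa>" "v = 1 / \<kappa> ^ 2" "w = 1 / \<kappa> ^ 3"
    have "v \<le> u" "w \<le> u" "0 \<le> u"
      using that by (auto simp: u_v_w_def self_le_power intro!: divide_left_mono)
    moreover have "circ_var_approx \<kappa> = u / 2 + v / 8 + w / 8"
      by (simp add: circ_var_approx_def u_v_w_def)
    moreover have "circ_var \<kappa> < 1" "a \<kappa> = 2 + u - circ_var \<kappa> - circ_var_approx \<kappa>"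
      using that by (simp_all add: circ_var_less_1 a_def u_v_w_def)
    ultimately show ?thesis
      by linarith
  qed
  have \<rho>_le: "\<bar>\<rho> \<kappa>\<bar> \<le> 1 / \<kappa> ^ 4" if "1 \<le> \<kappa>" for \<kappa>
  proof -
    define u v w where "u = 1 / \<kappa> ^ 4" "v = 1 / \<kappa> ^ 5" "w = 1 / \<kappa> ^ 6"
    have "v \<le> u" "w \<le> u" "0 \<le> u" "0 \<le> v" "0 \<le> w"
      using that by (auto simp: u_v_w_def intro!: divide_left_mono power_increasing)
    moreover have "\<rho> \<kappa> = 25 / 64 * u + 1 / 32 * v + 1 / 64 * w"
      by (simp add: \<rho>_def u_v_w_def)
    ultimately have "\<bar>\<rho> \<kappa>\<bar> \<le> u" by linarith
    then show ?thesis by (simp add: u_v_w_def)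
  qed
  have \<Phi>_decr: "\<Phi> \<kappa> \<le> \<Phi> 16" if "16 \<le> \<kappa>" for \<kappa>
  proof (rule DERIV_nonpos_imp_nonincreasing[OF that])
    fix t :: real assume t: "16 \<le> t" "t \<le> \<kappa>"
    define w where "w = 1 / t ^ 4"
    have "(\<Phi> has_real_derivative
        exp t * ((e t)\<^sup>2 + 2 * e t * (\<rho> t - a t * e t) - 2 / t ^ 8 + 16 / t ^ 9)) (at t)"
      unfolding \<Phi>_def using t
      by (auto intro!: derivative_eq_intros e_deriv simp: field_simps eval_nat_numeral)
    moreover have "(e t)\<^sup>2 + 2 * e t * (\<rho> t - a t * e t) - 2 / t ^ 8 + 16 / t ^ 9 \<le> 0"
    proof -
      \<comment> \<open>this is where the threshold 16 comes from: it lets one of the two copies of \<open>t\<^sup>-\<^sup>8\<close> absorb the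
        derivative of \<open>- 2 t\<^sup>-\<^sup>8\<close>; what remains is at most minus a perfect square\<close>
      have "16 / t ^ 9 = 16 / t * (1 / t ^ 8)" "1 / t ^ 8 = w\<^sup>2"
        by (simp_all add: w_def power_divide eval_nat_numeral)
      moreover have "16 / t * (1 / t ^ 8) \<le> 1 * (1 / t ^ 8)"
        using t by (intro mult_right_mono) auto
      ultimately have 1: "16 / t ^ 9 \<le> w\<^sup>2" "2 / t ^ 8 = 2 * w\<^sup>2" by auto
      have "\<bar>e t * \<rho> t\<bar> \<le> \<bar>e t\<bar> * w"
        using \<rho>_le[of t] t unfolding w_def abs_mult by (intro mult_left_mono) auto
      then have "e t * \<rho> t \<le> \<bar>e t\<bar> * w" by (rule abs_le_D1)
      moreover have "1 * (e t)\<^sup>2 \<le> a t * (e t)\<^sup>2"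
        using a_ge[of t] t by (intro mult_right_mono) auto
      ultimately have "(e t)\<^sup>2 + 2 * e t * (\<rho> t - a t * e t) - 2 / t ^ 8 + 16 / t ^ 9
           \<le> - (\<bar>e t\<bar> - w)\<^sup>2"
        using 1 by (simp add: power2_eq_square algebra_simps)
      then show ?thesis by (rule order_trans) simp
    qed
    ultimately show "\<exists>y. (\<Phi> has_real_derivative y) (at t) \<and> y \<le> 0"
      by (auto simp: mult_nonneg_nonpos)
  qed
  have "((\<lambda>\<kappa>::real. exp (- \<kappa>) * \<kappa> ^ 8) \<longlongrightarrow> 0) at_top"
    by real_asymp
  then have "((\<lambda>\<kappa>. \<Phi> 16 * (exp (- \<kappa>) * \<kappa> ^ 8)) \<longlongrightarrow> 0) at_top"
    by (rule tendsto_mult_right_zero)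
  then have "\<forall>\<^sub>F \<kappa> in at_top. \<Phi> 16 * (exp (- \<kappa>) * \<kappa> ^ 8) < 2"
    by (rule order_tendstoD) simp
  then show ?thesis
    using eventually_ge_at_top[of 16]
  proof eventually_elim
    case (elim \<kappa>)
    have small: "\<Phi> 16 * exp (- \<kappa>) \<le> 2 / \<kappa> ^ 8"
      using elim by (simp add: pos_le_divide_eq mult.assoc)
    have "exp \<kappa> * (\<Phi> 16 * exp (- \<kappa>)) = \<Phi> 16"
      by (simp add: exp_minus)
    with \<Phi>_decr[OF elim(2)]
    have "exp \<kappa> * ((e \<kappa>)\<^sup>2 - 2 / \<kappa> ^ 8) \<le> exp \<kappa> * (\<Phi> 16 * exp (- \<kappa>))"
      by (simp only: \<Phi>_def)
    then have "(e \<kappa>)\<^sup>2 - 2 / \<kappa> ^ 8 \<le> \<Phi> 16 * exp (- \<kappa>)" by simp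
    with small have "(e \<kappa>)\<^sup>2 \<le> (2 / \<kappa> ^ 4)\<^sup>2"
      by (simp add: power_divide flip: power_mult)
    then show ?case
      using elim(2) by (subst (asm) abs_le_square_iff[symmetric]) (simp add: e_def)
  qed
qed

section \<open>The asymptotic expansion of the logarithm of the Bessel function\<close>

text \<open>
  Squeeze \<open>I\<^sub>0\<^sup>2\<close> between the bound for \<open>I\<^sub>0\<^sup>2\<close> and the bound for \<open>I\<^sub>0 I\<^sub>1\<close> divided by \<open>I\<^sub>1/I\<^sub>0 \<rightarrow> 1\<close>. This fixes the
  constant \<open>2\<pi>\<close>, which the differential equation alone cannot see.
\<close>

lemma bessel_I0_limit:
  "((\<lambda>\<kappa>. (bessel_I 0 \<kappa>)\<^sup>2 * (2 * pi * \<kappa>) * exp (- 2 * \<kappa>)) \<longlongrightarrow> 1) at_top"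
proof (rule tendsto_sandwich)
  let ?r = "\<lambda>\<kappa>. 1 - circ_var_approx \<kappa> - 2 / \<kappa> ^ 4"
  let ?f = "\<lambda>\<kappa>. (bessel_I 0 \<kappa>)\<^sup>2 * (2 * pi * \<kappa>) * exp (- 2 * \<kappa>)"
  show "\<forall>\<^sub>F \<kappa> in at_top. sinh (2 * \<kappa>) * 2 * exp (- 2 * \<kappa>) \<le> ?f \<kappa>"
    using eventually_gt_at_top[of 0]
  proof eventually_elim
    case (elim \<kappa>)
    have "sinh (2 * \<kappa>) / (pi * \<kappa>) * (2 * pi * \<kappa>) * exp (- 2 * \<kappa>) \<le> ?f \<kappa>"
      using bessel_I0_square_lower[OF elim] elim by (intro mult_right_mono) auto
    then show ?case using elim by simp
  qed
  have "\<forall>\<^sub>F \<kappa> in at_top. 0 < ?r \<kappa>"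
    unfolding circ_var_approx_def by real_asymp
  then show "\<forall>\<^sub>F \<kappa> in at_top. ?f \<kappa> \<le> (cosh (2 * \<kappa>) - 1) * 2 * exp (- 2 * \<kappa>) / ?r \<kappa>"
    using eventually_gt_at_top[of 0] circ_var_asymptotics
  proof eventually_elim
    case (elim \<kappa>)
    have I: "bessel_I 0 \<kappa> > 0" using elim(2) by (rule bessel_I_pos)
    have "?r \<kappa> \<le> bessel_I 1 \<kappa> / bessel_I 0 \<kappa>"
      using elim(3) by (simp add: circ_var_def abs_le_iff)
    then have "?r \<kappa> * ?f \<kappa> \<le> bessel_I 1 \<kappa> / bessel_I 0 \<kappa> * ?f \<kappa>"
      using elim(2) by (intro mult_right_mono) auto
    also have "\<dots> = bessel_I 0 \<kappa> * bessel_I 1 \<kappa> * (2 * pi * \<kappa>) * exp (- 2 * \<kappa>)"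
      using I by (simp add: power2_eq_square)
    also have "\<dots> \<le> (cosh (2 * \<kappa>) - 1) / (pi * \<kappa>) * (2 * pi * \<kappa>) * exp (- 2 * \<kappa>)"
      using bessel_I0_I1_upper[OF elim(2)] elim(2) by (intro mult_right_mono) auto
    also have "\<dots> = (cosh (2 * \<kappa>) - 1) * 2 * exp (- 2 * \<kappa>)"
      using elim(2) by simp
    finally show ?case
      using elim(1) by (simp add: pos_le_divide_eq mult.commute)
  qed
  show "((\<lambda>\<kappa>::real. sinh (2 * \<kappa>) * 2 * exp (- 2 * \<kappa>)) \<longlongrightarrow> 1) at_top"
    unfolding sinh_field_def by real_asymp
  show "((\<lambda>\<kappa>::real. (cosh (2 * \<kappa>) - 1) * 2 * exp (- 2 * \<kappa>) / ?r \<kappa>) \<longlongrightarrow> 1) at_top"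
  proof (rule tendsto_eq_intros)
    show "((\<lambda>\<kappa>::real. (cosh (2 * \<kappa>) - 1) * 2 * exp (- 2 * \<kappa>)) \<longlongrightarrow> 1) at_top"
      unfolding cosh_field_def by real_asymp
    show "(?r \<longlongrightarrow> 1) at_top"
      unfolding circ_var_approx_def by real_asymp
  qed simp_all
qed

text \<open>
  The derivative of the left-hand side (without the absolute value) is minus the error of the circular variance,
  so it is at most \<open>2 \<kappa>\<^sup>-\<^sup>4\<close> in size, and the function itself tends to 0 by the leading-order limit. Integrating
  from infinity gives the bound; here this is done by monotonicity of \<open>\<plusminus>G(\<kappa>) - \<kappa>\<^sup>-\<^sup>3\<close>.
\<close>

lemma ln_bessel_I0_asymptotics:
  "\<forall>\<^sub>F \<kappa> in at_top.
     \<bar>ln (bessel_I 0 \<kappa>) - \<kappa> + ln (2 * pi * \<kappa>) / 2 - (1 / (8 * \<kappa>) + 1 / (16 * \<kappa> ^ 2))\<bar> \<le> 1 / \<kappa> ^ 3"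
proof -
  define G where "G = (\<lambda>\<kappa>. ln (bessel_I 0 \<kappa>) - \<kappa> + ln (2 * pi * \<kappa>) / 2
                          - (1 / (8 * \<kappa>) + 1 / (16 * \<kappa> ^ 2)))"
  have G_limit: "(G \<longlongrightarrow> 0) at_top"
  proof -
    have "((\<lambda>\<kappa>::real. 1 / (8 * \<kappa>) + 1 / (16 * \<kappa> ^ 2)) \<longlongrightarrow> 0) at_top"
      by real_asymp
    from tendsto_diff[OF tendsto_divide[OF tendsto_ln[OF bessel_I0_limit] tendsto_const[of 2]] this]
    have "((\<lambda>\<kappa>. ln ((bessel_I 0 \<kappa>)\<^sup>2 * (2 * pi * \<kappa>) * exp (- 2 * \<kappa>)) / 2
             - (1 / (8 * \<kappa>) + 1 / (16 * \<kappa> ^ 2))) \<longlongrightarrow> ln 1 / 2 - 0) at_top"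
      by simp
    moreover have "\<forall>\<^sub>F \<kappa> in at_top. ln ((bessel_I 0 \<kappa>)\<^sup>2 * (2 * pi * \<kappa>) * exp (- 2 * \<kappa>)) / 2
             - (1 / (8 * \<kappa>) + 1 / (16 * \<kappa> ^ 2)) = G \<kappa>"
      using eventually_gt_at_top[of 0]
    proof eventually_elim
      case (elim \<kappa>)
      then show ?case
        using bessel_I_pos[OF elim, of 0] unfolding G_def
        by (simp add: ln_mult ln_realpow)
    qed
    ultimately show ?thesis by (simp add: tendsto_cong)
  qed
  have G_deriv: "(G has_real_derivative circ_var_approx \<kappa> - circ_var \<kappa>) (at \<kappa>)"
    if "0 < \<kappa>" for \<kappa>
  proof -
    have "(G has_real_derivative
       bessel_I 1 \<kappa> / bessel_I 0 \<kappa> - 1 + 1 / \<kappa> / 2 - (- 1 / (8 * \<kappa>\<^sup>2) - 1 / (8 * \<kappa> ^ 3))) (at \<kappa>)"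
      unfolding G_def using that bessel_I_pos[OF that, of 0]
      by (auto intro!: derivative_eq_intros DERIV_bessel_I0 simp: field_simps eval_nat_numeral)
    then show ?thesis
      by (rule DERIV_cong) (simp add: circ_var_approx_def circ_var_def)
  qed
  obtain K where K: "\<And>\<kappa>. K \<le> \<kappa> \<Longrightarrow> \<bar>circ_var \<kappa> - circ_var_approx \<kappa>\<bar> \<le> 2 / \<kappa> ^ 4"
    using circ_var_asymptotics by (auto simp: eventually_at_top_linorder)
  have bound: "s * G \<kappa> \<le> 1 / \<kappa> ^ 3" if "max 1 K \<le> \<kappa>" "\<bar>s\<bar> = 1" for s \<kappa>
  proof -
    define h where "h = (\<lambda>\<kappa>. s * G \<kappa> - 1 / \<kappa> ^ 3)"
    have "h \<kappa> \<le> h t" if t: "\<kappa> \<le> t" for t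
    proof (rule DERIV_nonneg_imp_nondecreasing[OF t])
      fix u assume u: "\<kappa> \<le> u" "u \<le> t"
      with \<open>max 1 K \<le> \<kappa>\<close> have u0: "0 < u" "K \<le> u" by auto
      have "(h has_real_derivative s * (circ_var_approx u - circ_var u) + 3 / u ^ 4) (at u)"
        unfolding h_def using u0
        by (auto intro!: derivative_eq_intros G_deriv simp: field_simps eval_nat_numeral)
      moreover have "\<bar>s * (circ_var_approx u - circ_var u)\<bar> \<le> 2 / u ^ 4"
        using K[OF u0(2)] \<open>\<bar>s\<bar> = 1\<close> by (simp add: abs_mult abs_minus_commute)
      moreover have "2 / u ^ 4 \<le> 3 / u ^ 4"
        using u0 by (simp add: divide_right_mono)
      ultimately show "\<exists>y. (h has_real_derivative y) (at u) \<and> 0 \<le> y"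
        by (intro exI[of _ "s * (circ_var_approx u - circ_var u) + 3 / u ^ 4"]) linarith
    qed
    then have "\<forall>\<^sub>F t in at_top. h \<kappa> \<le> h t"
      by (auto simp: eventually_at_top_linorder)
    moreover have "(h \<longlongrightarrow> s * 0 - 0) at_top"
      unfolding h_def by (intro tendsto_diff tendsto_mult tendsto_const G_limit) real_asymp
    ultimately have "h \<kappa> \<le> 0"
      by (intro tendsto_lowerbound[where f = h and F = at_top]) auto
    then show ?thesis by (simp add: h_def)
  qed
  have "\<forall>\<^sub>F \<kappa> in at_top. \<bar>G \<kappa>\<bar> \<le> 1 / \<kappa> ^ 3"
    using eventually_ge_at_top[of "max 1 K"]
    by eventually_elim (use bound[of _ 1] bound[of _ "-1"] in \<open>auto simp: abs_le_iff\<close>)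
  then show ?thesis by (simp add: G_def)
qed

section \<open>Expansion of the logarithm of the density ratio\<close>

text \<open>
  A Taylor bound valid on the whole line: this is why the logarithmic expansion below holds for all \<open>x\<close>.
\<close>

lemma cos_taylor6: "\<bar>cos x - (1 - x ^ 2 / 2 + x ^ 4 / 24 - x ^ 6 / 720)\<bar> \<le> x ^ 8 / 40320" for x :: real
proof -
  obtain t where "cos x = (\<Sum>m<8. cos_coeff m * x ^ m) + cos (t + 1 / 2 * real 8 * pi) / fact 8 * x ^ 8"
    using Maclaurin_cos_expansion[of x 8] by blast
  moreover have "(\<Sum>m<8. cos_coeff m * x ^ m) = 1 - x ^ 2 / 2 + x ^ 4 / 24 - x ^ 6 / 720"
    by (simp add: cos_coeff_def fact_numeral lessThan_nat_numeral)
  moreover have "\<bar>cos (t + 1 / 2 * real 8 * pi) / fact 8 * x ^ 8\<bar> \<le> 1 / fact 8 * x ^ 8"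
    unfolding abs_mult abs_divide
    by (intro mult_mono) (auto simp: power_even_abs divide_right_mono)
  ultimately show ?thesis by (simp add: fact_numeral)
qed

text \<open>
  The factor by which \<open>\<kappa> (x - \<mu>)\<^sup>2\<close> differs from the square of the standardised variable; it tends to 1.
\<close>

definition scaled_var :: "real \<Rightarrow> real" where
  "scaled_var \<kappa> = 2 * \<kappa> * circ_var \<kappa>"

lemma scaled_var_bounds:
  "\<forall>\<^sub>F \<kappa> in at_top. \<bar>scaled_var \<kappa> - (1 + 1 / (4 * \<kappa>) + 1 / (4 * \<kappa> ^ 2))\<bar> \<le> 4 / \<kappa> ^ 3"
  using circ_var_asymptotics eventually_gt_at_top[of 0]
proof eventually_elim
  case (elim \<kappa>)
  have "\<bar>2 * \<kappa> * (circ_var \<kappa> - circ_var_approx \<kappa>)\<bar> \<le> 2 * \<kappa> * (2 / \<kappa> ^ 4)"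
    using elim unfolding abs_mult by (intro mult_mono) auto
  moreover have "2 * \<kappa> * (2 / \<kappa> ^ 4) = 4 / \<kappa> ^ 3"
    using elim by (simp add: eval_nat_numeral)
  moreover have "2 * \<kappa> * (circ_var \<kappa> - circ_var_approx \<kappa>)
      = scaled_var \<kappa> - (1 + 1 / (4 * \<kappa>) + 1 / (4 * \<kappa> ^ 2))"
    using elim by (simp add: scaled_var_def circ_var_approx_def field_simps eval_nat_numeral)
  ultimately show ?case by simp
qed

text \<open>
  Each bound holds for the two explicit functions \<open>L\<close> and \<open>U\<close> that enclose \<open>scaled_var\<close>, and passes to it by
  monotonicity of powers and of the logarithm. The orders for the square and the cube are those that
  leave \<open>\<kappa>\<^sup>-\<^sup>3\<close> after multiplication with the prefactors \<open>1/\<kappa>\<close> of \<open>d\<^sup>4\<close> and \<open>1/\<kappa>\<^sup>2\<close> of \<open>d\<^sup>6\<close>.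
\<close>

lemma scaled_var_expansions:
  "\<forall>\<^sub>F \<kappa> in at_top.
     1 / 2 \<le> scaled_var \<kappa> \<and> scaled_var \<kappa> ^ 4 \<le> 2 \<and>
     \<bar>ln (scaled_var \<kappa>) - (1 / (4 * \<kappa>) + 7 / (32 * \<kappa> ^ 2))\<bar> \<le> 5 / \<kappa> ^ 3 \<and>
     \<bar>scaled_var \<kappa> ^ 2 - (1 + 1 / (2 * \<kappa>))\<bar> \<le> 1 / \<kappa> ^ 2 \<and>
     \<bar>scaled_var \<kappa> ^ 3 - 1\<bar> \<le> 1 / \<kappa>"
proof -
  define L where "L = (\<lambda>\<kappa>::real. 1 + 1 / (4 * \<kappa>) + 1 / (4 * \<kappa> ^ 2) - 4 / \<kappa> ^ 3)"
  define U where "U = (\<lambda>\<kappa>::real. 1 + 1 / (4 * \<kappa>) + 1 / (4 * \<kappa> ^ 2) + 4 / \<kappa> ^ 3)"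
  have "\<forall>\<^sub>F \<kappa>::real in at_top. 1 / 2 \<le> L \<kappa>" unfolding L_def U_def by real_asymp
  moreover have "\<forall>\<^sub>F \<kappa>::real in at_top. U \<kappa> ^ 4 \<le> 2" unfolding L_def U_def by real_asymp
  moreover have "\<forall>\<^sub>F \<kappa>::real in at_top. 1 / (4 * \<kappa>) + 7 / (32 * \<kappa> ^ 2) - 5 / \<kappa> ^ 3 \<le> ln (L \<kappa>)" unfolding L_def U_def by real_asymp
  moreover have "\<forall>\<^sub>F \<kappa>::real in at_top. ln (U \<kappa>) \<le> 1 / (4 * \<kappa>) + 7 / (32 * \<kappa> ^ 2) + 5 / \<kappa> ^ 3" unfolding L_def U_def by real_asymp
  moreover have "\<forall>\<^sub>F \<kappa>::real in at_top. 1 + 1 / (2 * \<kappa>) - 1 / \<kappa> ^ 2 \<le> L \<kappa> ^ 2" unfolding L_def U_def by real_asymp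
  moreover have "\<forall>\<^sub>F \<kappa>::real in at_top. U \<kappa> ^ 2 \<le> 1 + 1 / (2 * \<kappa>) + 1 / \<kappa> ^ 2" unfolding L_def U_def by real_asymp
  moreover have "\<forall>\<^sub>F \<kappa>::real in at_top. 1 - 1 / \<kappa> \<le> L \<kappa> ^ 3" unfolding L_def U_def by real_asymp
  moreover have "\<forall>\<^sub>F \<kappa>::real in at_top. U \<kappa> ^ 3 \<le> 1 + 1 / \<kappa>" unfolding L_def U_def by real_asymp
  ultimately show ?thesis
    using scaled_var_bounds
  proof eventually_elim
    case (elim \<kappa>)
    let ?A = "scaled_var \<kappa>"
    have LU: "L \<kappa> \<le> ?A" "?A \<le> U \<kappa>" "0 < L \<kappa>" "0 < ?A"
      using elim(1,9) by (auto simp: L_def U_def abs_le_iff)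
    have "L \<kappa> ^ n \<le> ?A ^ n" "?A ^ n \<le> U \<kappa> ^ n" for n
      using LU by (auto intro!: power_mono)
    from this[of 2] this[of 3] this[of 4]
    have "?A ^ 4 \<le> 2" "\<bar>?A ^ 2 - (1 + 1 / (2 * \<kappa>))\<bar> \<le> 1 / \<kappa> ^ 2" "\<bar>?A ^ 3 - 1\<bar> \<le> 1 / \<kappa>"
      using elim(2,5-8) by linarith+
    moreover have "ln (L \<kappa>) \<le> ln ?A" "ln ?A \<le> ln (U \<kappa>)"
      using LU by (simp_all add: ln_mono)
    then have "\<bar>ln ?A - (1 / (4 * \<kappa>) + 7 / (32 * \<kappa> ^ 2))\<bar> \<le> 5 / \<kappa> ^ 3"
      using elim(3,4) by linarith
    moreover have "1 / 2 \<le> ?A" using LU elim(1) by linarith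
    ultimately show ?case by blast
  qed
qed

definition vm_log_main :: "real \<Rightarrow> real \<Rightarrow> real" where
  "vm_log_main \<kappa> d = 1 / \<kappa> * (d ^ 4 / 24 - d ^ 2 / 8)
     + 1 / \<kappa> ^ 2 * (- (d ^ 6 / 720) + d ^ 4 / 48 - d ^ 2 / 8 + 3 / 64)"

lemma vm_nu_eq_sqrt: "vm_nu \<kappa> = sqrt (circ_var \<kappa>)"
  by (simp add: vm_nu_def circ_var_def)

text \<open>
  Everything about the density ratio that is needed, as exact identities: the expansion only concerns
  \<open>scaled_var\<close>, \<open>I\<^sub>0\<close> and the cosine.
\<close>

lemma vm_ratio_exact:
  fixes \<kappa> \<mu> x :: real
  assumes \<kappa>: "0 < \<kappa>" and A: "0 < scaled_var \<kappa>"
  defines "d \<equiv> vm_delta_tilde \<mu> \<kappa> x"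
  shows "0 < vm_ratio \<mu> \<kappa> x"
    and "(x - \<mu>) ^ 2 = scaled_var \<kappa> * d ^ 2 / \<kappa>"
    and "ln (vm_ratio \<mu> \<kappa> x) =
       ln (scaled_var \<kappa>) / 2 - (ln (bessel_I 0 \<kappa>) - \<kappa> + ln (2 * pi * \<kappa>) / 2)
         + \<kappa> * (cos (x - \<mu>) - 1) + d ^ 2 / 2"
proof -
  have I: "0 < bessel_I 0 \<kappa>" using \<kappa> by (rule bessel_I_pos)
  have q: "0 < circ_var \<kappa>"
    using A \<kappa> by (simp add: scaled_var_def zero_less_mult_iff)
  have \<nu>: "0 < vm_nu \<kappa>" "vm_nu \<kappa> ^ 2 = circ_var \<kappa>"
    using q by (simp_all add: vm_nu_eq_sqrt)
  have ratio: "vm_ratio \<mu> \<kappa> x =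
      sqrt 2 * vm_nu \<kappa> * exp (\<kappa> * cos (x - \<mu>)) * sqrt (2 * pi) * exp (d ^ 2 / 2) / (2 * pi * bessel_I 0 \<kappa>)"
    by (simp add: vm_ratio_def vm_density_def std_normal_density_def d_def exp_minus field_simps)
  then show "0 < vm_ratio \<mu> \<kappa> x"
    using I \<nu> by simp
  show "(x - \<mu>) ^ 2 = scaled_var \<kappa> * d ^ 2 / \<kappa>"
    using \<nu> \<kappa> q by (simp add: d_def vm_delta_tilde_def vm_delta_def scaled_var_def power_divide power_mult_distrib)
  have "ln (vm_ratio \<mu> \<kappa> x) =
      ln 2 / 2 + ln (circ_var \<kappa>) / 2 + \<kappa> * cos (x - \<mu>) + ln (2 * pi) / 2 + d ^ 2 / 2
        - (ln (2 * pi) + ln (bessel_I 0 \<kappa>))"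
    unfolding ratio vm_nu_eq_sqrt using I q
    by (simp add: ln_mult ln_div ln_sqrt)
  moreover have "ln (scaled_var \<kappa>) = ln 2 + ln \<kappa> + ln (circ_var \<kappa>)"
    using \<kappa> q by (simp add: scaled_var_def ln_mult)
  moreover have "ln (2 * pi * \<kappa>) = ln (2 * pi) + ln \<kappa>"
    using \<kappa> by (simp add: ln_mult)
  ultimately show "ln (vm_ratio \<mu> \<kappa> x) =
       ln (scaled_var \<kappa>) / 2 - (ln (bessel_I 0 \<kappa>) - \<kappa> + ln (2 * pi * \<kappa>) / 2)
         + \<kappa> * (cos (x - \<mu>) - 1) + d ^ 2 / 2"
    by (simp add: algebra_simps add_divide_distrib)
qed

text \<open>
  Insert \<open>(x - \<mu>)\<^sup>2 = A d\<^sup>2 / \<kappa>\<close> into the Taylor polynomial of the cosine. The term \<open>d\<^sup>2 / 2\<close> from the normal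
  density cancels the leading term, and the difference to the claimed main part is a polynomial in \<open>d\<^sup>2\<close> of
  degree 3 whose coefficients are all \<open>O(\<kappa>\<^sup>-\<^sup>3)\<close>, plus the Taylor remainder of size \<open>d\<^sup>8 / \<kappa>\<^sup>3\<close>. The constant
  does not depend on \<open>\<mu>\<close> or \<open>x\<close>.
\<close>

lemma vm_log_expansion:
  "\<forall>\<^sub>F \<kappa> in at_top. \<forall>\<mu> x. 0 < vm_ratio \<mu> \<kappa> x \<and>
     \<bar>ln (vm_ratio \<mu> \<kappa> x) - vm_log_main \<kappa> (vm_delta_tilde \<mu> \<kappa> x)\<bar>
       \<le> 6 * ((1 + vm_delta_tilde \<mu> \<kappa> x ^ 8) / \<kappa> ^ 3)"
  using scaled_var_expansions scaled_var_bounds ln_bessel_I0_asymptotics eventually_ge_at_top[of 1]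
proof eventually_elim
  case (elim \<kappa>)
  show ?case
  proof (intro allI)
    fix \<mu> x
    define A where "A = scaled_var \<kappa>"
    define d where "d = vm_delta_tilde \<mu> \<kappa> x"
    define y where "y = x - \<mu>"
    define c where "c = ln A / 2 - (ln (bessel_I 0 \<kappa>) - \<kappa> + ln (2 * pi * \<kappa>) / 2)"
    define R where "R = cos y - (1 - y ^ 2 / 2 + y ^ 4 / 24 - y ^ 6 / 720)"
    define w where "w = 1 / \<kappa> ^ 3"
    have \<kappa>: "1 \<le> \<kappa>" "0 < \<kappa>" using elim(4) by auto
    have w: "0 \<le> w" "1 / \<kappa> * (1 / \<kappa> ^ 2) = w" "4 / \<kappa> ^ 3 = 4 * w" "5 / \<kappa> ^ 3 = 5 * w"
      using \<kappa> by (auto simp: w_def eval_nat_numeral)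
    have A: "0 < A" "A ^ 4 \<le> 2" "\<bar>A - (1 + 1 / (4 * \<kappa>) + 1 / (4 * \<kappa> ^ 2))\<bar> \<le> 4 * w"
      "\<bar>A ^ 2 - (1 + 1 / (2 * \<kappa>))\<bar> \<le> 1 / \<kappa> ^ 2" "\<bar>A ^ 3 - 1\<bar> \<le> 1 / \<kappa>"
      "\<bar>ln A - (1 / (4 * \<kappa>) + 7 / (32 * \<kappa> ^ 2))\<bar> \<le> 5 * w"
      using elim(1,2) unfolding A_def w by auto
    have "0 < scaled_var \<kappa>" using A(1) by (simp add: A_def)
    note ratio = vm_ratio_exact[OF \<kappa>(2) this, where \<mu> = \<mu> and x = x, folded A_def d_def y_def]
    have "\<bar>ln (bessel_I 0 \<kappa>) - \<kappa> + ln (2 * pi * \<kappa>) / 2 - (1 / (8 * \<kappa>) + 1 / (16 * \<kappa> ^ 2))\<bar> \<le> w"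
      using elim(3) by (simp add: w_def)
    moreover have "1 / (4 * \<kappa>) / 2 = 1 / (8 * \<kappa>)"
      "7 / (32 * \<kappa> ^ 2) / 2 - 1 / (16 * \<kappa> ^ 2) = 3 / 64 / \<kappa> ^ 2"
      using \<kappa> by (simp_all add: field_simps)
    \<comment> \<open>\<open>3/64 = 7/64 - 1/16\<close>: half the logarithm of \<open>A\<close> minus the expansion of \<open>ln I\<^sub>0\<close>\<close>
    ultimately have c: "\<bar>c - 3 / 64 / \<kappa> ^ 2\<bar> \<le> 7 / 2 * w"
      using A(6) unfolding c_def by linarith
    have y2: "y ^ (2 * n) = (A / \<kappa>) ^ n * d ^ (2 * n)" for n
      using ratio(2) by (simp add: power_mult power_mult_distrib[symmetric])
    have R: "\<bar>\<kappa> * R\<bar> \<le> 2 / 40320 * (w * d ^ 8)"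
    proof -
      have "\<bar>\<kappa> * R\<bar> \<le> \<kappa> * (y ^ 8 / 40320)"
        using cos_taylor6[of y] \<kappa> unfolding R_def abs_mult by (intro mult_mono) auto
      also have "y ^ 8 = (A / \<kappa>) ^ 4 * d ^ 8" using y2[of 4] by simp
      also have "\<kappa> * ((A / \<kappa>) ^ 4 * d ^ 8 / 40320) = A ^ 4 * (w * d ^ 8 / 40320)"
        using \<kappa> by (simp add: w_def power_divide eval_nat_numeral)
      also have "\<dots> \<le> 2 * (w * d ^ 8 / 40320)"
        using A(2) w(1) by (intro mult_right_mono) auto
      finally show ?thesis by simp
    qed
    have E: "ln (vm_ratio \<mu> \<kappa> x) - vm_log_main \<kappa> d =
       (c - 3 / 64 / \<kappa> ^ 2)
       - (A - (1 + 1 / (4 * \<kappa>) + 1 / (4 * \<kappa> ^ 2))) * d ^ 2 / 2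
       + 1 / \<kappa> * (A ^ 2 - (1 + 1 / (2 * \<kappa>))) * d ^ 4 / 24
       - 1 / \<kappa> ^ 2 * (A ^ 3 - 1) * d ^ 6 / 720
       + \<kappa> * R"
    proof -
      have "\<kappa> * (cos y - 1) = - \<kappa> * (y ^ 2) / 2 + \<kappa> * y ^ 4 / 24 - \<kappa> * y ^ 6 / 720 + \<kappa> * R"
        by (simp add: R_def algebra_simps)
      also have "\<dots> = - A * d ^ 2 / 2 + A ^ 2 * d ^ 4 / \<kappa> / 24 - A ^ 3 * d ^ 6 / \<kappa> ^ 2 / 720 + \<kappa> * R"
        using y2[of 1] y2[of 2] y2[of 3] \<kappa>
        by (simp add: power_divide power2_eq_square power3_eq_cube)
      finally have "ln (vm_ratio \<mu> \<kappa> x) = c - A * d ^ 2 / 2 + A ^ 2 * d ^ 4 / \<kappa> / 24 - A ^ 3 * d ^ 6 / \<kappa> ^ 2 / 720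
          + \<kappa> * R + d ^ 2 / 2"
        unfolding ratio(3) c_def by simp
      moreover define v where "v = inverse \<kappa>"
      then have "b / \<kappa> = b * v" "b / \<kappa> ^ 2 = b * v ^ 2" "b / (n * \<kappa>) = b * v / n" "b / (n * \<kappa> ^ 2) = b * v ^ 2 / n"
        for b n by (simp_all add: divide_inverse power_inverse)
      ultimately show ?thesis
        unfolding vm_log_main_def by (simp only:) (simp add: algebra_simps power2_eq_square add_divide_distrib diff_divide_distrib)
    qed
    have d2: "\<bar>(A - (1 + 1 / (4 * \<kappa>) + 1 / (4 * \<kappa> ^ 2))) * d ^ 2\<bar> \<le> 4 * w * d ^ 2"
      using A(3) unfolding abs_mult by (intro mult_mono) auto
    have "\<bar>1 / \<kappa> * (A ^ 2 - (1 + 1 / (2 * \<kappa>))) * d ^ 4\<bar> \<le> 1 / \<kappa> * (1 / \<kappa> ^ 2) * d ^ 4"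
      using A(4) \<kappa> unfolding abs_mult by (intro mult_mono) auto
    then have d4: "\<bar>1 / \<kappa> * (A ^ 2 - (1 + 1 / (2 * \<kappa>))) * d ^ 4\<bar> \<le> w * d ^ 4"
      unfolding w .
    have "\<bar>1 / \<kappa> ^ 2 * (A ^ 3 - 1) * d ^ 6\<bar> \<le> 1 / \<kappa> ^ 2 * (1 / \<kappa>) * d ^ 6"
      using A(5) \<kappa> unfolding abs_mult by (intro mult_mono) auto
    then have d6: "\<bar>1 / \<kappa> ^ 2 * (A ^ 3 - 1) * d ^ 6\<bar> \<le> w * d ^ 6"
      unfolding w(2)[symmetric] by (simp add: mult.commute)
    have pw: "w * d ^ n \<le> w * (1 + d ^ 8)" if "even n" "n \<le> 8" for n
    proof (rule mult_left_mono[OF _ w(1)])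
      show "d ^ n \<le> 1 + d ^ 8"
      proof (cases "\<bar>d\<bar> \<le> 1")
        case True
        then have "\<bar>d\<bar> ^ n \<le> 1" by (simp add: power_le_one)
        then show ?thesis using that by (simp add: power_even_abs add_increasing2)
      next
        case False
        then have "\<bar>d\<bar> ^ n \<le> \<bar>d\<bar> ^ 8" using that by (intro power_increasing) auto
        then show ?thesis using that by (simp add: power_even_abs)
      qed
    qed
    have "\<bar>ln (vm_ratio \<mu> \<kappa> x) - vm_log_main \<kappa> d\<bar> \<le> 6 * (w * (1 + d ^ 8))"
    proof -
      have combine: "\<bar>p - x2 / 2 + x4 / 24 - x6 / 720 + r\<bar> \<le> 6 * W"
        if "\<bar>p\<bar> \<le> 7 / 2 * W" "\<bar>x2\<bar> \<le> 4 * W" "\<bar>x4\<bar> \<le> W" "\<bar>x6\<bar> \<le> W" "\<bar>r\<bar> \<le> 2 / 40320 * W"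
        for p x2 x4 x6 r W :: real
        using that by linarith
      show ?thesis
        unfolding E
      proof (rule combine)
        show "\<bar>c - 3 / 64 / \<kappa>\<^sup>2\<bar> \<le> 7 / 2 * (w * (1 + d ^ 8))"
          using mult_left_mono[OF pw[of 0], of "7 / 2"] by (intro order_trans[OF c]) simp
        show "\<bar>(A - (1 + 1 / (4 * \<kappa>) + 1 / (4 * \<kappa>\<^sup>2))) * d\<^sup>2\<bar> \<le> 4 * (w * (1 + d ^ 8))"
          using mult_left_mono[OF pw[of 2], of 4] by (intro order_trans[OF d2]) simp
        show "\<bar>1 / \<kappa> * (A\<^sup>2 - (1 + 1 / (2 * \<kappa>))) * d ^ 4\<bar> \<le> w * (1 + d ^ 8)"
          by (rule order_trans[OF d4 pw]) simp_all
        show "\<bar>1 / \<kappa>\<^sup>2 * (A ^ 3 - 1) * d ^ 6\<bar> \<le> w * (1 + d ^ 8)"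
          by (rule order_trans[OF d6 pw]) simp_all
        show "\<bar>\<kappa> * R\<bar> \<le> 2 / 40320 * (w * (1 + d ^ 8))"
          by (rule order_trans[OF R mult_left_mono[OF pw]]) simp_all
      qed
    qed
    then show "0 < vm_ratio \<mu> \<kappa> x \<and> \<bar>ln (vm_ratio \<mu> \<kappa> x) - vm_log_main \<kappa> (vm_delta_tilde \<mu> \<kappa> x)\<bar>
       \<le> 6 * ((1 + vm_delta_tilde \<mu> \<kappa> x ^ 8) / \<kappa> ^ 3)"
      using ratio(1) by (simp add: w_def d_def)
  qed
qed

section \<open>Expansion of the density ratio itself\<close>

text \<open>
  Think of \<open>z\<close> as a small parameter for which \<open>a\<close>, \<open>b\<close> and the error of \<open>L\<close> have orders 1, 2 and 3. Then the exponential
  series through order 2 leaves only terms of order 3. Boundedness of \<open>z\<close> by \<open>N\<close> controls all higher orders.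
\<close>

lemma exp_perturbation:
  fixes N :: real
  assumes "1 \<le> N"
  defines "K \<equiv> 1 + N + 6 * N\<^sup>2"
  defines "C \<equiv> 6 + (1 + 6 * N) * (1 + K) + K ^ 3 * exp (N * K)"
  assumes z: "0 \<le> z" "z \<le> N"
    and a: "\<bar>a\<bar> \<le> z" and b: "\<bar>b\<bar> \<le> z\<^sup>2" and L: "\<bar>L - (a + b)\<bar> \<le> 6 * z ^ 3"
  shows "\<bar>exp L - (1 + a + b + a\<^sup>2 / 2)\<bar> \<le> C * z ^ 3"
proof -
  have K: "1 \<le> K" using assms(1) by (simp add: K_def)
  have z2: "z\<^sup>2 \<le> z * N" and z3: "z ^ 3 \<le> z\<^sup>2 * N" and z3': "z ^ 3 \<le> z * N\<^sup>2"
    using z mult_left_mono[OF z(2), of z] mult_left_mono[OF z(2), of "z\<^sup>2"]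
      mult_left_mono[OF power_mono[OF z(2,1), of 2], of z]
    by (simp_all add: power2_eq_square power3_eq_cube mult.assoc)
  have La: "\<bar>L - a\<bar> \<le> z\<^sup>2 * (1 + 6 * N)"
    using b L z3 by (simp add: distrib_left)
  have "\<bar>L\<bar> \<le> \<bar>a\<bar> + \<bar>b\<bar> + \<bar>L - (a + b)\<bar>" by linarith
  also have "\<dots> \<le> z + z * N + 6 * (z * N\<^sup>2)"
    using a b L z2 z3' by linarith
  also have "\<dots> = z * K" by (simp add: K_def algebra_simps)
  finally have L1: "\<bar>L\<bar> \<le> z * K" .
  obtain t where t: "\<bar>t\<bar> \<le> \<bar>L\<bar>" "exp L = (\<Sum>m<3. L ^ m / fact m) + exp t / fact 3 * L ^ 3"
    using Maclaurin_exp_le[of L 3] by blast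
  have "\<bar>exp t / fact 3 * L ^ 3\<bar> \<le> exp (N * K) * (z * K) ^ 3"
    unfolding abs_mult
  proof (rule mult_mono)
    have "t \<le> N * K"
      using t(1) L1 mult_right_mono[OF z(2), of K] K by linarith
    then have "exp t \<le> exp (N * K)" by simp
    then have "exp t / 6 \<le> exp (N * K)" using exp_gt_zero[of t] by linarith
    then show "\<bar>exp t / fact 3\<bar> \<le> exp (N * K)"
      by (simp add: fact_numeral abs_div_pos)
    show "\<bar>L ^ 3\<bar> \<le> (z * K) ^ 3"
      unfolding power_abs using L1 by (intro power_mono) auto
  qed auto
  moreover have "(z * K) ^ 3 = K ^ 3 * z ^ 3" by (simp add: power_mult_distrib)
  moreover have "exp L = 1 + L + L\<^sup>2 / 2 + exp t / fact 3 * L ^ 3"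
    using t(2) by (simp add: numeral_3_eq_3 power2_eq_square)
  ultimately have T: "\<bar>exp L - (1 + L + L\<^sup>2 / 2)\<bar> \<le> K ^ 3 * exp (N * K) * z ^ 3"
    by (simp add: mult_ac)
  have "\<bar>L\<^sup>2 - a\<^sup>2\<bar> = \<bar>L - a\<bar> * \<bar>L + a\<bar>"
    by (simp add: abs_mult[symmetric] power2_eq_square algebra_simps)
  also have "\<dots> \<le> (z\<^sup>2 * (1 + 6 * N)) * (z * (1 + K))"
    using La L1 a z K assms(1) by (intro mult_mono) (auto simp: distrib_left)
  also have "\<dots> = (1 + 6 * N) * (1 + K) * z ^ 3"
    by (simp add: power2_eq_square power3_eq_cube)
  finally have Q: "\<bar>L\<^sup>2 - a\<^sup>2\<bar> \<le> (1 + 6 * N) * (1 + K) * z ^ 3" .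
  have "\<bar>exp L - (1 + a + b + a\<^sup>2 / 2)\<bar> \<le> \<bar>exp L - (1 + L + L\<^sup>2 / 2)\<bar> + \<bar>L - (a + b)\<bar> + \<bar>L\<^sup>2 - a\<^sup>2\<bar>"
    by linarith
  also have "\<dots> \<le> C * z ^ 3"
    using T L Q unfolding C_def distrib_right by linarith
  finally show ?thesis .
qed

definition vm_ratio_main :: "real \<Rightarrow> real \<Rightarrow> real" where
  "vm_ratio_main \<kappa> d = 1 + 1 / \<kappa> * (d ^ 4 / 24 - d ^ 2 / 8)
     + 1 / \<kappa> ^ 2 * (d ^ 8 / 1152 - 19 * d ^ 6 / 2880 + 11 * d ^ 4 / 384 - d ^ 2 / 8 + 3 / 64)"

text \<open>
  The small parameter is \<open>z = (1 + d\<^sup>4) / \<kappa>\<close>: the coefficients of \<open>1/\<kappa>\<close> and \<open>1/\<kappa>\<^sup>2\<close> in the logarithm are bounded by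
  \<open>1 + d\<^sup>4\<close> and \<open>(1 + d\<^sup>4)\<^sup>2\<close>, and \<open>z\<^sup>3\<close> is comparable to the claimed error \<open>(1 + d\<^sup>1\<^sup>2) / \<kappa>\<^sup>3\<close>. The hypothesis
  \<open>d\<^sup>4 \<le> M \<kappa>\<close> says precisely that \<open>z\<close> stays bounded.
\<close>

lemma exp_vm_log_main:
  fixes M :: real
  assumes "0 \<le> M"
  obtains C where "0 < C"
    "\<And>\<kappa> d L. \<lbrakk>1 \<le> \<kappa>; d ^ 4 \<le> M * \<kappa>; \<bar>L - vm_log_main \<kappa> d\<bar> \<le> 6 * ((1 + d ^ 8) / \<kappa> ^ 3)\<rbrakk>
        \<Longrightarrow> \<bar>exp L - vm_ratio_main \<kappa> d\<bar> \<le> C * ((1 + d ^ 12) / \<kappa> ^ 3)"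
proof
  define N where "N = M + 1"
  define K where "K = 1 + N + 6 * N\<^sup>2"
  define C where "C = 6 + (1 + 6 * N) * (1 + K) + K ^ 3 * exp (N * K)"
  have N: "1 \<le> N" using assms by (simp add: N_def)
  have "0 < K" using N by (simp add: K_def add_pos_nonneg)
  then have C: "0 < C"
    using N by (simp add: C_def add_pos_nonneg)
  then show "0 < 4 * C" by simp
  fix \<kappa> d L :: real
  assume \<kappa>: "1 \<le> \<kappa>" and d: "d ^ 4 \<le> M * \<kappa>"
    and L: "\<bar>L - vm_log_main \<kappa> d\<bar> \<le> 6 * ((1 + d ^ 8) / \<kappa> ^ 3)"
  define s where "s = 1 + d ^ 4"
  define z where "z = s / \<kappa>"
  define P where "P = d ^ 4 / 24 - d ^ 2 / 8"
  define Q where "Q = - (d ^ 6 / 720) + d ^ 4 / 48 - d ^ 2 / 8 + 3 / 64"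
  have s: "1 \<le> s" "0 \<le> d ^ 2" "0 \<le> d ^ 4" "d ^ 2 \<le> s" "d ^ 4 \<le> s"
  proof -
    have "2 * d ^ 2 \<le> d ^ 4 + 1" "0 \<le> d ^ 2" "0 \<le> d ^ 4"
      using sum_squares_bound[of "d ^ 2" 1] by (simp_all flip: power_mult)
    then show "1 \<le> s" "0 \<le> d ^ 2" "0 \<le> d ^ 4" "d ^ 2 \<le> s" "d ^ 4 \<le> s"
      unfolding s_def by linarith+
  qed
  have "s \<le> N * \<kappa>"
    using d \<kappa> by (simp add: s_def N_def distrib_right)
  then have z: "0 \<le> z" "z \<le> N"
    using s \<kappa> by (auto simp: z_def pos_divide_le_eq)
  have "\<bar>P\<bar> \<le> s"
    using s unfolding P_def by linarith
  then have a: "\<bar>P / \<kappa>\<bar> \<le> z"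
    using \<kappa> by (simp add: z_def divide_right_mono)
  have "d ^ 6 = d ^ 4 * d ^ 2" by (simp flip: power_add)
  also have "\<dots> \<le> s * s" using s by (intro mult_mono) auto
  finally have "d ^ 6 \<le> s\<^sup>2" "0 \<le> d ^ 6" by (simp_all add: power2_eq_square)
  moreover have "s \<le> s\<^sup>2" using s by (simp add: self_le_power)
  ultimately have "\<bar>Q\<bar> \<le> s\<^sup>2"
    using s unfolding Q_def by linarith
  then have b: "\<bar>Q / \<kappa>\<^sup>2\<bar> \<le> z\<^sup>2"
    using \<kappa> by (simp add: z_def power_divide divide_right_mono)
  have "1 + d ^ 8 \<le> s ^ 2" by (simp add: s_def power2_sum flip: power_mult)
  also have "\<dots> \<le> s ^ 3" using s by (intro power_increasing) auto
  finally have "(1 + d ^ 8) / \<kappa> ^ 3 \<le> z ^ 3"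
    using \<kappa> by (simp add: z_def power_divide divide_right_mono)
  then have "\<bar>L - vm_log_main \<kappa> d\<bar> \<le> 6 * z ^ 3"
    using L by linarith
  then have "\<bar>L - (P / \<kappa> + Q / \<kappa>\<^sup>2)\<bar> \<le> 6 * z ^ 3"
    by (simp add: vm_log_main_def P_def Q_def)
  from exp_perturbation[OF N z a b this]
  have "\<bar>exp L - (1 + P / \<kappa> + Q / \<kappa>\<^sup>2 + (P / \<kappa>)\<^sup>2 / 2)\<bar> \<le> C * z ^ 3"
    by (simp add: C_def K_def)
  also have "1 + P / \<kappa> + Q / \<kappa>\<^sup>2 + (P / \<kappa>)\<^sup>2 / 2 = vm_ratio_main \<kappa> d"
    using \<kappa> by (simp add: vm_ratio_main_def P_def Q_def field_simps) (simp add: eval_nat_numeral algebra_simps)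
  also have "C * z ^ 3 \<le> C * (4 * ((1 + d ^ 12) / \<kappa> ^ 3))"
  proof -
    have "s ^ 3 \<le> 4 * (1 + d ^ 12)"
    proof -
      \<comment> \<open>the power mean inequality \<open>(1 + u)\<^sup>3 \<le> 4 (1 + u\<^sup>3)\<close> at \<open>u = d\<^sup>4\<close>\<close>
      have "0 \<le> 3 * (1 + d ^ 4) * (d ^ 4 - 1)\<^sup>2" by simp
      also have "\<dots> = 4 * (1 + d ^ 12) - s ^ 3"
        by (simp add: s_def eval_nat_numeral algebra_simps)
      finally show ?thesis by simp
    qed
    then have "z ^ 3 \<le> 4 * ((1 + d ^ 12) / \<kappa> ^ 3)"
      using \<kappa> by (simp add: z_def power_divide divide_right_mono)
    then show ?thesis using C by (intro mult_left_mono) auto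
  qed
  finally show "\<bar>exp L - vm_ratio_main \<kappa> d\<bar> \<le> 4 * C * ((1 + d ^ 12) / \<kappa> ^ 3)"
    by (simp only: mult_ac)
qed

text \<open>
  The exponents combine to \<open>\<bar>\<delta>\<^sub>x\<bar> \<le> \<eta> \<kappa>\<^sup>1\<^sup>/\<^sup>4\<close>, so on the shrinking bulk the fourth power of
  the standardised variable is at most of order \<open>\<kappa>\<close>.
\<close>

lemma vm_bulk_quartic_bound:
  assumes "0 < \<kappa>" "x \<in> vm_bulk \<mu> \<kappa> (\<kappa> powr (- 1 / 4) * \<eta>)"
  shows "vm_delta_tilde \<mu> \<kappa> x ^ 4 \<le> \<eta> ^ 4 / 4 * \<kappa>"
proof -
  have "\<bar>vm_delta \<mu> \<kappa> x\<bar> \<le> \<kappa> powr (- 1 / 4) * \<eta> * \<kappa> powr (1 / 2)"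
    using assms(2) by (simp add: vm_bulk_def)
  also have "\<dots> = \<eta> * \<kappa> powr (1 / 4)"
    by (simp add: powr_add[symmetric])
  finally have "\<bar>vm_delta \<mu> \<kappa> x\<bar> ^ 4 \<le> (\<eta> * \<kappa> powr (1 / 4)) ^ 4"
    by (intro power_mono) auto
  also have "\<dots> = \<eta> ^ 4 * \<kappa>"
    using assms(1) by (simp add: power_mult_distrib powr_power)
  finally have "vm_delta \<mu> \<kappa> x ^ 4 \<le> \<eta> ^ 4 * \<kappa>" by (simp add: power_even_abs)
  moreover have "vm_delta_tilde \<mu> \<kappa> x ^ 4 = vm_delta \<mu> \<kappa> x ^ 4 / 4"
  proof -
    have "sqrt 2 ^ 4 = ((sqrt 2)\<^sup>2)\<^sup>2" by (simp only: power_mult[symmetric]) simp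
    then show ?thesis by (simp add: vm_delta_tilde_def power_divide)
  qed
  ultimately show ?thesis by simp
qed

theorem theorem1:
  shows
    "(\<forall>\<eta>::real. 0 < \<eta> \<and> \<eta> < 1 \<longrightarrow>
        unif_bigo (\<lambda>\<mu> \<kappa>. vm_bulk \<mu> \<kappa> \<eta>)
          (\<lambda>\<mu> \<kappa> x. let d = vm_delta_tilde \<mu> \<kappa> x in
             ln (vm_ratio \<mu> \<kappa> x)
             - (1 / \<kappa> * (d ^ 4 / 24 - d ^ 2 / 8)
                + 1 / \<kappa> ^ 2 * (- (d ^ 6 / 720) + d ^ 4 / 48 - d ^ 2 / 8 + 3 / 64)))
          (\<lambda>\<mu> \<kappa> x. (1 + \<bar>vm_delta_tilde \<mu> \<kappa> x\<bar> ^ 8) / \<kappa> ^ 3))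
     \<and> (\<forall>\<eta>'::real. 0 < \<eta>' \<longrightarrow>
        unif_bigo (\<lambda>\<mu> \<kappa>. vm_bulk \<mu> \<kappa> (\<kappa> powr (- 1 / 4) * \<eta>'))
          (\<lambda>\<mu> \<kappa> x. let d = vm_delta_tilde \<mu> \<kappa> x in
             vm_ratio \<mu> \<kappa> x
             - (1 + 1 / \<kappa> * (d ^ 4 / 24 - d ^ 2 / 8)
                + 1 / \<kappa> ^ 2 * (d ^ 8 / 1152 - 19 * d ^ 6 / 2880 + 11 * d ^ 4 / 384
                               - d ^ 2 / 8 + 3 / 64)))
          (\<lambda>\<mu> \<kappa> x. (1 + \<bar>vm_delta_tilde \<mu> \<kappa> x\<bar> ^ 12) / \<kappa> ^ 3))"
proof (intro conjI allI impI)
  fix \<eta> :: real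
  show "unif_bigo (\<lambda>\<mu> \<kappa>. vm_bulk \<mu> \<kappa> \<eta>)
          (\<lambda>\<mu> \<kappa> x. let d = vm_delta_tilde \<mu> \<kappa> x in
             ln (vm_ratio \<mu> \<kappa> x)
             - (1 / \<kappa> * (d ^ 4 / 24 - d ^ 2 / 8)
                + 1 / \<kappa> ^ 2 * (- (d ^ 6 / 720) + d ^ 4 / 48 - d ^ 2 / 8 + 3 / 64)))
          (\<lambda>\<mu> \<kappa> x. (1 + \<bar>vm_delta_tilde \<mu> \<kappa> x\<bar> ^ 8) / \<kappa> ^ 3)"
    unfolding unif_bigo_def Let_def vm_log_main_def[symmetric]
  proof (intro exI[of _ 6] conjI allI)
    fix \<mu> :: real
    show "\<forall>\<^sub>F \<kappa> in at_top. \<forall>x\<in>vm_bulk \<mu> \<kappa> \<eta>.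
        \<bar>ln (vm_ratio \<mu> \<kappa> x) - vm_log_main \<kappa> (vm_delta_tilde \<mu> \<kappa> x)\<bar>
          \<le> 6 * \<bar>(1 + \<bar>vm_delta_tilde \<mu> \<kappa> x\<bar> ^ 8) / \<kappa> ^ 3\<bar>"
      using vm_log_expansion eventually_gt_at_top[of 0]
      by eventually_elim (simp add: power_even_abs)
  qed simp
next
  fix \<eta> :: real
  assume \<eta>: "0 < \<eta>"
  obtain C where C: "0 < C"
    "\<And>\<kappa> d L. \<lbrakk>1 \<le> \<kappa>; d ^ 4 \<le> \<eta> ^ 4 / 4 * \<kappa>; \<bar>L - vm_log_main \<kappa> d\<bar> \<le> 6 * ((1 + d ^ 8) / \<kappa> ^ 3)\<rbrakk>
        \<Longrightarrow> \<bar>exp L - vm_ratio_main \<kappa> d\<bar> \<le> C * ((1 + d ^ 12) / \<kappa> ^ 3)"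
    using exp_vm_log_main[of "\<eta> ^ 4 / 4"] \<eta> by auto
  show "unif_bigo (\<lambda>\<mu> \<kappa>. vm_bulk \<mu> \<kappa> (\<kappa> powr (- 1 / 4) * \<eta>))
          (\<lambda>\<mu> \<kappa> x. let d = vm_delta_tilde \<mu> \<kappa> x in
             vm_ratio \<mu> \<kappa> x
             - (1 + 1 / \<kappa> * (d ^ 4 / 24 - d ^ 2 / 8)
                + 1 / \<kappa> ^ 2 * (d ^ 8 / 1152 - 19 * d ^ 6 / 2880 + 11 * d ^ 4 / 384
                               - d ^ 2 / 8 + 3 / 64)))
          (\<lambda>\<mu> \<kappa> x. (1 + \<bar>vm_delta_tilde \<mu> \<kappa> x\<bar> ^ 12) / \<kappa> ^ 3)"
    unfolding unif_bigo_def Let_def vm_ratio_main_def[symmetric]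
  proof (intro exI[of _ C] conjI allI)
    fix \<mu> :: real
    show "\<forall>\<^sub>F \<kappa> in at_top. \<forall>x\<in>vm_bulk \<mu> \<kappa> (\<kappa> powr (- 1 / 4) * \<eta>).
        \<bar>vm_ratio \<mu> \<kappa> x - vm_ratio_main \<kappa> (vm_delta_tilde \<mu> \<kappa> x)\<bar>
          \<le> C * \<bar>(1 + \<bar>vm_delta_tilde \<mu> \<kappa> x\<bar> ^ 12) / \<kappa> ^ 3\<bar>"
      using vm_log_expansion eventually_ge_at_top[of 1]
    proof eventually_elim
      case (elim \<kappa>)
      show ?case
      proof
        fix x assume x: "x \<in> vm_bulk \<mu> \<kappa> (\<kappa> powr (- 1 / 4) * \<eta>)"
        have "vm_delta_tilde \<mu> \<kappa> x ^ 4 \<le> \<eta> ^ 4 / 4 * \<kappa>"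
          using vm_bulk_quartic_bound[OF _ x] elim(2) by simp
        from C(2)[OF elim(2) this, of "ln (vm_ratio \<mu> \<kappa> x)"] elim
        show "\<bar>vm_ratio \<mu> \<kappa> x - vm_ratio_main \<kappa> (vm_delta_tilde \<mu> \<kappa> x)\<bar>
          \<le> C * \<bar>(1 + \<bar>vm_delta_tilde \<mu> \<kappa> x\<bar> ^ 12) / \<kappa> ^ 3\<bar>"
          by (simp add: power_even_abs)
      qed
    qed
  qed (rule C(1))
qed

end
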